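(* Let $x_1^1=(0.4417,-4.7665)$, $x_1^2=(-0.27748,1.0397)$, $x_1^3=(1.4826,4.7896)$; $x_2^1=(-2.1054,-3.9784)$, $x_2^2=(3.5763,-1.8988)$, $x_2^3=(3.328,-1.558)$; $x_3^1=(-3.6728,0.23451)$, $x_3^2=(1.6988,-2.2917)$, $x_3^3=(-1.1644,-2.386)$ be points of $\mathbb{R}^2$ (all decimals are exact), and let $\mu_i=\frac13\left(\delta_{x_i^1}+\delta_{x_i^2}+\delta_{x_i^3}\right)$ for $i=1,2,3$. For $a,b,e\in\{1,2,3\}$ write $x^{abe}:=(x_1^a,x_2^b,x_3^e)\in(\mathbb{R}^2)^3$. Consider the problem of minimizing $$\int_{(\mathbb{R}^2)^3}\sum_{i,j=1}^3|x_i-x_j|^2\,d\gamma(x_1,x_2,x_3)$$ over $\gamma\in\Pi(\mu_1,\mu_2,\mu_3)$. Then: (i) the measure $\gamma=\frac16\left[\delta_{x^{113}}+\delta_{x^{122}}+\delta_{x^{211}}+\delta_{x^{223}}+\delta_{x^{331}}+\delta_{x^{332}}\right]$ is a minimizer; (ii) among the $36$ measures of the form $\frac13\sum_{k=1}^3\delta_{x^{k\,\sigma_2(k)\,\sigma_3(k)}}$, with $\sigma_2,\sigma_3$ permutations of $\{1,2,3\}$, the minimal cost is attained by $\frac13\left[\delta_{x^{113}}+\delta_{x^{222}}+\delta_{x^{331}}\right]$, and this cost is strictly higher than the minimal cost over $\Pi(\mu_1,\mu_2,\mu_3)$; consequently the problem does not admit a Monge solution; (iii) there does not exist a Wasserstein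 barycenter $\nu$ of $\mu_1,\mu_2,\mu_3$ with $\nu\in E_3$.
   Context: $\Pi(\mu_1,\mu_2,\mu_3)$ is the set of Borel probability measures on $(\mathbb{R}^2)^3$ whose marginals are $\mu_1,\mu_2,\mu_3$. A Monge solution is a minimizer which is concentrated on the graph of a function over the first variable, i.e. on $\{(x_1,T_2(x_1),T_3(x_1))\}$ for some maps $T_2,T_3$; for these marginals (each uniform on three distinct points) the elements of $\Pi(\mu_1,\mu_2,\mu_3)$ of this form are exactly the measures $\frac13\sum_{k=1}^3\delta_{x^{k\,\sigma_2(k)\,\sigma_3(k)}}$ with $\sigma_2,\sigma_3$ permutations of $\{1,2,3\}$. The set of $m$-empirical measures on $\mathbb{R}^d$ is $E_m:=\{\frac1m\sum_{i=1}^m\delta_{x_i}: x_1,\dots,x_m\in\mathbb{R}^d\}$; here $m=3$ and $d=2$. The Wasserstein distance between probability measures is $W_2(\mu,\nu)=\sqrt{\inf_{\gamma\in\Pi(\mu,\nu)}\int|x-y|^2\,d\gamma(x,y)}$, where $\Pi(\mu,\nu)$ is the set of couplings of $\mu$ and $\nu$. A Wasserstein barycenter of $\mu_1,\mu_2,\mu_3$ (with equal weights) is a minimizer of $\nu\mapsto\sum_{i=1}^3W_2^2(\nu,\mu_i)$ among all probability measures $\nu$ on $\mathbb{R}^2$. *)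

theory Defs
  imports "HOL-Probability.Probability"
begin

section \<open>Multi-marginal transport plans\<close>

text \<open>The Borel probability measures on \<^typ>\<open>'a\<close> are \<^term>\<open>space (prob_algebra borel)\<close>,
  see \<^emph>\<open>space_prob_algebra\<close>.\<close>

definition multi_couplings ::
    "('n::finite \<Rightarrow> 'a::euclidean_space measure) \<Rightarrow> ('a ^ 'n) measure set" where
  "multi_couplings \<mu> =
    {\<gamma> \<in> space (prob_algebra borel). \<forall>i. distr \<gamma> borel (\<lambda>x. x $ i) = \<mu> i}"

text \<open>The integrand is nonnegative; using the Lebesgue integral with values in \<^typ>\<open>ennreal\<close>
  means that plans with a non-integrable cost get the value \<open>\<infinity>\<close>.\<close>

definition multi_cost :: "('a::euclidean_space ^ 'n::finite) measure \<Rightarrow> ennreal" where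
  "multi_cost \<gamma> =
    (\<integral>\<^sup>+ x. ennreal (\<Sum>i\<in>UNIV. \<Sum>j\<in>UNIV. (norm (x $ i - x $ j))\<^sup>2) \<partial>\<gamma>)"

definition multi_minimizer ::
    "('n::finite \<Rightarrow> 'a::euclidean_space measure) \<Rightarrow> ('a ^ 'n) measure \<Rightarrow> bool" where
  "multi_minimizer \<mu> \<gamma> \<longleftrightarrow> is_arg_min multi_cost (\<lambda>\<gamma>. \<gamma> \<in> multi_couplings \<mu>) \<gamma>"

text \<open>No measurability of the maps is required: \<open>AE\<close> only asks that the complement of the graph
  is contained in a Borel null set.\<close>

definition concentrated_on_graph :: "('a::euclidean_space ^ 3) measure \<Rightarrow> bool" where
  "concentrated_on_graph \<gamma> \<longleftrightarrow>
    (\<exists>T\<^sub>2 T\<^sub>3 :: 'a \<Rightarrow> 'a. AE x in \<gamma>. x $ 2 = T\<^sub>2 (x $ 1) \<and> x $ 3 = T\<^sub>3 (x $ 1))"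

definition monge_solution ::
    "(3 \<Rightarrow> 'a::euclidean_space measure) \<Rightarrow> ('a ^ 3) measure \<Rightarrow> bool" where
  "monge_solution \<mu> \<gamma> \<longleftrightarrow> multi_minimizer \<mu> \<gamma> \<and> concentrated_on_graph \<gamma>"


section \<open>Empirical measures\<close>

text \<open>\<open>emp [x\<^sub>1, \<dots>, x\<^sub>m]\<close> is the measure \<open>1/m (\<delta>\<^bsub>x\<^sub>1\<^esub> + \<dots> + \<delta>\<^bsub>x\<^sub>m\<^esub>)\<close>, where
  \<open>\<delta>\<^bsub>x\<^esub>\<close> is \<^term>\<open>return borel x\<close>; repetitions are allowed. The lemma
  \<open>emeasure_emp\<close> shows that the set function below is indeed a measure.\<close>

definition emp :: "'a::topological_space list \<Rightarrow> 'a measure" where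
  "emp xs = measure_of UNIV (sets borel)
    (\<lambda>A. (\<Sum>x\<leftarrow>xs. emeasure (return borel x) A) / of_nat (length xs))"

definition empirical_measures :: "nat \<Rightarrow> 'a::topological_space measure set" where
  "empirical_measures m = {emp xs | xs. length xs = m}"

lemma space_emp [simp]: "space (emp xs) = UNIV"
  by (simp add: emp_def space_measure_of_conv)

lemma sets_emp [simp, measurable_cong]: "sets (emp xs) = sets borel"
  by (simp add: emp_def) (metis sets.sigma_sets_eq space_borel)

lemma emeasure_emp:
  assumes "A \<in> sets borel"
  shows "emeasure (emp xs) A =
    (\<Sum>x\<leftarrow>xs. emeasure (return borel x) A) / of_nat (length xs)"
proof -
  let ?S = "\<lambda>A. \<Sum>x\<leftarrow>xs. emeasure (return borel x) A"
  let ?\<mu> = "\<lambda>A. ?S A / of_nat (length xs)"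
  have list: "(\<Sum>n. ?S (B n)) = ?S (\<Union>n. B n)"
    if B: "range B \<subseteq> sets borel" "disjoint_family B" for B :: "nat \<Rightarrow> 'a set"
  proof (induction xs)
    case (Cons x xs)
    have "(\<Sum>n. emeasure (return borel x) (B n)) = emeasure (return borel x) (\<Union>n. B n)"
      using B by (intro suminf_emeasure) auto
    with Cons show ?case
      by (simp add: suminf_add[symmetric] del: emeasure_return)
  qed simp
  have "countably_additive (sets borel) ?\<mu>"
    unfolding countably_additive_def
    by (auto simp: divide_ennreal_def ennreal_suminf_multc list simp del: emeasure_return)
  moreover have "positive (sets borel) ?\<mu>"
    by (induction xs) (auto simp: positive_def)
  moreover have "sigma_algebra UNIV (sets (borel :: 'a measure))"
    by (metis sets.sigma_algebra_axioms space_borel)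
  ultimately show ?thesis
    unfolding emp_def using assms by (intro emeasure_measure_of_sigma) auto
qed

lemma emp_prob:
  assumes "xs \<noteq> []"
  shows "emp xs \<in> space (prob_algebra borel)"
proof -
  have "(\<Sum>x\<leftarrow>xs. emeasure (return borel x) UNIV) = of_nat (length xs)"
    by (induction xs) auto
  then have "emeasure (emp xs) (space (emp xs)) = 1"
    using assms by (simp add: emeasure_emp ennreal_divide_self of_nat_less_top
        del: emeasure_return)
  then show ?thesis
    by (auto simp: space_prob_algebra intro: prob_spaceI)
qed


section \<open>Wasserstein distance and barycenters\<close>

definition couplings ::
    "'a::euclidean_space measure \<Rightarrow> 'a measure \<Rightarrow> ('a \<times> 'a) measure set" where
  "couplings \<mu> \<nu> =
    {\<gamma> \<in> space (prob_algebra borel). distr \<gamma> borel fst = \<mu> \<and> distr \<gamma> borel snd = \<nu>}"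

text \<open>The square root on \<open>[0, \<infinity>]\<close>; the case distinction is needed because
  \<^term>\<open>enn2real \<infinity> = 0\<close>.\<close>

definition ennsqrt :: "ennreal \<Rightarrow> ennreal" where
  "ennsqrt a = (if a = \<infinity> then \<infinity> else ennreal (sqrt (enn2real a)))"

lemma ennsqrt_squared: "(ennsqrt a)\<^sup>2 = a"
  by (cases a) (auto simp: ennsqrt_def ennreal_power power2_eq_square ennreal_mult[symmetric]
      ennreal_top_mult)

text \<open>The barycenter problem ranges over all probability measures, including those without
  second moment, so the distance takes values in \<open>[0, \<infinity>]\<close>.\<close>

definition W2 :: "'a::euclidean_space measure \<Rightarrow> 'a measure \<Rightarrow> ennreal" where
  "W2 \<mu> \<nu> = ennsqrt (INF \<gamma>\<in>couplings \<mu> \<nu>. \<integral>\<^sup>+ (x, y). ennreal ((norm (x - y))\<^sup>2) \<partial>\<gamma>)"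

definition wasserstein_barycenter ::
    "('n::finite \<Rightarrow> 'a::euclidean_space measure) \<Rightarrow> 'a measure \<Rightarrow> bool" where
  "wasserstein_barycenter \<mu> \<nu> \<longleftrightarrow>
    is_arg_min (\<lambda>\<nu>. \<Sum>i\<in>UNIV. (W2 \<nu> (\<mu> i))\<^sup>2) (\<lambda>\<nu>. \<nu> \<in> space (prob_algebra borel)) \<nu>"


section \<open>The marginals\<close>

text \<open>\<open>pt $ i $ a\<close> is the point \<open>x\<^sub>i\<^sup>a\<close>. In the index type \<^typ>\<open>3\<close> the numeral \<open>3\<close> equals \<open>0\<close>,
  so \<open>1\<close>, \<open>2\<close>, \<open>3\<close> are exactly its three distinct elements.\<close>

definition pt :: "real ^ 2 ^ 3 ^ 3" where
  "pt = vector
    [vector [vector [0.4417, - 4.7665], vector [- 0.27748, 1.0397], vector [1.4826, 4.7896]],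
     vector [vector [- 2.1054, - 3.9784], vector [3.5763, - 1.8988], vector [3.328, - 1.558]],
     vector [vector [- 3.6728, 0.23451], vector [1.6988, - 2.2917], vector [- 1.1644, - 2.386]]]"

definition marg :: "3 \<Rightarrow> (real ^ 2) measure" where
  "marg i = emp [pt $ i $ 1, pt $ i $ 2, pt $ i $ 3]"

definition xx :: "3 \<Rightarrow> 3 \<Rightarrow> 3 \<Rightarrow> real ^ 2 ^ 3" where
  "xx a b e = vector [pt $ 1 $ a, pt $ 2 $ b, pt $ 3 $ e]"

definition perm_plan :: "(3 \<Rightarrow> 3) \<Rightarrow> (3 \<Rightarrow> 3) \<Rightarrow> (real ^ 2 ^ 3) measure" where
  "perm_plan \<sigma>\<^sub>2 \<sigma>\<^sub>3 = emp (map (\<lambda>k. xx k (\<sigma>\<^sub>2 k) (\<sigma>\<^sub>3 k)) [1, 2, 3])"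

definition perm_plans :: "(real ^ 2 ^ 3) measure set" where
  "perm_plans = {perm_plan \<sigma>\<^sub>2 \<sigma>\<^sub>3 | \<sigma>\<^sub>2 \<sigma>\<^sub>3. bij \<sigma>\<^sub>2 \<and> bij \<sigma>\<^sub>3}"

end

theory Submission
  imports Defs
begin

text \<open>
  All marginals are uniform on three points, so the multi-marginal problem is a linear program over
  nonnegative \<open>3\<times>3\<times>3\<close> arrays, and the permutation plans are only some of the vertices of its
  feasible set: for three marginals there is no analogue of Birkhoff's theorem. The nine points
  are such that the optimum, about \<open>136.055\<close>, is attained at the vertex \<open>split_plan\<close> that
  splits masses, and the best permutation plan, at about \<open>136.130\<close>, misses it by a small margin.

  Optimality of \<open>split_plan\<close> is certified by a dual solution (\<open>potential\<close>,
  \<open>potential_feasible\<close>) through weak duality (\<open>multi_coupling_weak_duality\<close>). The best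
  permutation plan is found by comparing all pairs of permutations using the table of the 27 costs
  (\<open>cost_table\<close>, \<open>perm_cost_ge\<close>). A coupling on a graph over the first variable is a
  permutation plan (\<open>graph_coupling_is_perm_plan\<close>), so it cannot be optimal.

  For the barycenters, the sum of the squared distances of a point \<open>y\<close> to \<open>x\<^sub>1\<close>, \<open>x\<^sub>2\<close>, \<open>x\<^sub>3\<close> is at
  least a sixth of the cost of the triple, with equality if \<open>y\<close> is its mean
  (\<open>sum_norm_diff_squares\<close>). The image of \<open>split_plan\<close> under the mean therefore has a value of at
  most a sixth of the optimal cost (\<open>barycenter_value_le_multi_cost\<close>). A measure
  \<open>1/3 (\<delta>\<^bsub>y\<^sub>1\<^esub> + \<delta>\<^bsub>y\<^sub>2\<^esub> + \<delta>\<^bsub>y\<^sub>3\<^esub>)\<close>, in contrast, is transported to each marginal most cheaply by a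
  permutation (\<open>W2_unif_ge_assignment\<close>, which rests on Birkhoff's theorem for two marginals), and
  these permutations combine to a permutation plan. So its value is at least a sixth of the cost
  of the best permutation plan (\<open>empirical_barycenter_value_ge\<close>), which is strictly larger.
\<close>

section \<open>Uniform measures on finite families of points\<close>

text \<open>The uniform measure on a finite family of points, as the law of a point whose index is chosen
  uniformly. Integrals against it become integrals against a probability mass function, and
  families indexed by \<^typ>\<open>3\<close> can be permuted freely, which is awkward for lists.\<close>

definition unif :: "('k::finite \<Rightarrow> 'a::topological_space) \<Rightarrow> 'a measure" where
  "unif x = distr (measure_pmf (pmf_of_set UNIV)) borel x"

lemma space_unif [simp]: "space (unif x) = UNIV"
  and sets_unif [simp, measurable_cong]: "sets (unif x) = sets borel"
  by (simp_all add: unif_def)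

lemma nn_integral_unif:
  fixes x :: "'k::finite \<Rightarrow> 'a::topological_space"
  assumes "f \<in> borel_measurable borel"
  shows "(\<integral>\<^sup>+ z. f z \<partial>unif x) = (\<Sum>k\<in>UNIV. f (x k)) / of_nat CARD('k)"
  unfolding unif_def using assms
  by (subst nn_integral_distr) (auto simp: nn_integral_pmf_of_set ennreal_of_nat_eq_real_of_nat)

lemma emeasure_unif:
  fixes x :: "'k::finite \<Rightarrow> 'a::topological_space"
  assumes "A \<in> sets borel"
  shows "emeasure (unif x) A = (\<Sum>k\<in>UNIV. indicator A (x k)) / of_nat CARD('k)"
  using nn_integral_unif[of "indicator A" x] assms by simp

lemma distr_unif:
  assumes "f \<in> borel_measurable borel"
  shows "distr (unif x) borel f = unif (\<lambda>k. f (x k))"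
  unfolding unif_def using assms by (subst distr_distr) (auto simp: o_def)

lemma AE_unif:
  fixes x :: "'k::finite \<Rightarrow> 'a::t1_space"
  shows "AE z in unif x. z \<in> range x"
  unfolding unif_def
  by (subst AE_distr_iff) (auto simp: AE_measure_pmf_iff intro!: borel_closed finite_imp_closed)

lemma emeasure_unif_singleton_pos:
  fixes x :: "'k::finite \<Rightarrow> 'a::t1_space"
  shows "emeasure (unif x) {z} > 0 \<longleftrightarrow> z \<in> range x"
  by (subst emeasure_unif)
    (auto simp: zero_less_iff_neq_zero ennreal_divide_eq_0_iff split: split_indicator)

lemma range_eq_if_unif_eq:
  fixes x y :: "'k::finite \<Rightarrow> 'a::t1_space"
  assumes "unif x = unif y"
  shows "range x = range y"
proof -
  have range: "range z = {p. emeasure (unif z) {p} > 0}" for z :: "'k \<Rightarrow> 'a"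
    by (simp add: emeasure_unif_singleton_pos)
  show ?thesis unfolding range assms ..
qed

lemma emp_3: "emp [x 1, x 2, x (3::3)] = unif x"
  by (rule measure_eqI) (simp_all add: emeasure_emp emeasure_unif sum_3 add.assoc)

lemma emp_eq_distr:
  assumes "xs \<noteq> []"
  shows "emp xs = distr (measure_pmf (pmf_of_set {..<length xs})) borel (nth xs)"
proof (rule measure_eqI)
  fix A assume "A \<in> sets (emp xs)"
  then have A: "A \<in> sets borel" by simp
  have "(\<Sum>i<length xs. indicator A (xs ! i)) = (\<Sum>x\<leftarrow>xs. indicator A x :: ennreal)"
    by (simp add: sum_list_sum_nth atLeast0LessThan)
  moreover have "emeasure (distr (measure_pmf (pmf_of_set {..<length xs})) borel (nth xs)) A
      = (\<integral>\<^sup>+ z. indicator A z \<partial>distr (measure_pmf (pmf_of_set {..<length xs})) borel (nth xs))"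
    using A by simp
  ultimately show "emeasure (emp xs) A
      = emeasure (distr (measure_pmf (pmf_of_set {..<length xs})) borel (nth xs)) A"
    using A assms
    by (simp add: emeasure_emp nn_integral_distr nn_integral_pmf_of_set
        ennreal_of_nat_eq_real_of_nat lessThan_empty_iff del: nn_integral_indicator)
qed simp

lemma nn_integral_emp:
  assumes "xs \<noteq> []" "f \<in> borel_measurable borel"
  shows "(\<integral>\<^sup>+ z. f z \<partial>emp xs) = (\<Sum>x\<leftarrow>xs. f x) / of_nat (length xs)"
  using assms
  by (simp add: emp_eq_distr nn_integral_distr nn_integral_pmf_of_set lessThan_empty_iff
      ennreal_of_nat_eq_real_of_nat sum_list_sum_nth atLeast0LessThan)

lemma distr_emp:
  assumes "f \<in> borel_measurable borel"
  shows "distr (emp xs) borel f = emp (map f xs)"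
proof (rule measure_eqI)
  fix A assume "A \<in> sets (distr (emp xs) borel f)"
  moreover from this have "f -` A \<in> sets borel"
    using assms by (metis measurable_sets_borel sets_distr)
  ultimately show "emeasure (distr (emp xs) borel f) A = emeasure (emp (map f xs)) A"
    using assms by (simp add: emeasure_distr emeasure_emp o_def indicator_def)
qed simp

section \<open>Multi-marginal plans and barycenters\<close>

lemma borel_measurable_vec_component [measurable]:
  "(\<lambda>x :: 'a::euclidean_space ^ 'n::finite. x $ i) \<in> borel_measurable borel"
  by (intro borel_measurable_continuous_onI continuous_intros)

text \<open>The potentials take values in \<^typ>\<open>ennreal\<close>, so that no integrability of the plan or of
  the cost has to be checked; the price is that dual solutions must be made nonnegative.\<close>

lemma multi_coupling_weak_duality:
  fixes \<mu> :: "'n::finite \<Rightarrow> 'a::euclidean_space measure"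
  assumes \<gamma>: "\<gamma> \<in> multi_couplings \<mu>"
    and \<phi>: "\<And>i. \<phi> i \<in> borel_measurable borel"
    and le: "AE x in \<gamma>. (\<Sum>i\<in>UNIV. \<phi> i (x $ i))
               \<le> ennreal (\<Sum>i\<in>UNIV. \<Sum>j\<in>UNIV. (norm (x $ i - x $ j))\<^sup>2)"
  shows "(\<Sum>i\<in>UNIV. \<integral>\<^sup>+ z. \<phi> i z \<partial>\<mu> i) \<le> multi_cost \<gamma>"
proof -
  have [measurable_cong]: "sets \<gamma> = sets borel"
    using \<gamma> by (simp add: multi_couplings_def space_prob_algebra)
  note [measurable] = \<phi>
  have "(\<integral>\<^sup>+ z. \<phi> i z \<partial>\<mu> i) = (\<integral>\<^sup>+ x. \<phi> i (x $ i) \<partial>\<gamma>)" for i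
  proof -
    have "\<mu> i = distr \<gamma> borel (\<lambda>x. x $ i)"
      using \<gamma> by (simp add: multi_couplings_def)
    then show ?thesis by (simp add: nn_integral_distr)
  qed
  then have "(\<Sum>i\<in>UNIV. \<integral>\<^sup>+ z. \<phi> i z \<partial>\<mu> i) = (\<integral>\<^sup>+ x. (\<Sum>i\<in>UNIV. \<phi> i (x $ i)) \<partial>\<gamma>)"
    by (simp add: nn_integral_sum)
  also have "\<dots> \<le> multi_cost \<gamma>"
    unfolding multi_cost_def by (rule nn_integral_mono_AE[OF le])
  finally show ?thesis .
qed

text \<open>Expand the squares of \<open>(y - x j) - (y - x i)\<close>; the cross terms add up to the last summand.
  That summand vanishes if \<open>y\<close> is the mean of the points, and is nonpositive in general. This
  identity is the link between the multi-marginal cost and the barycenter functional.\<close>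

lemma sum_norm_diff_squares:
  fixes x :: "'n::finite \<Rightarrow> 'a::real_inner"
  shows "(\<Sum>i\<in>UNIV. \<Sum>j\<in>UNIV. (norm (x i - x j))\<^sup>2)
    = 2 * real CARD('n) * (\<Sum>i\<in>UNIV. (norm (y - x i))\<^sup>2) - 2 * (norm (\<Sum>i\<in>UNIV. y - x i))\<^sup>2"
proof -
  define a where "a i = y - x i" for i
  have "(norm (x i - x j))\<^sup>2 = (norm (a i))\<^sup>2 + (norm (a j))\<^sup>2 - 2 * (a i \<bullet> a j)" for i j
    by (simp add: a_def power2_norm_eq_inner algebra_simps inner_commute)
  note this[simp]
  have "(\<Sum>i\<in>UNIV. \<Sum>j\<in>UNIV. (norm (x i - x j))\<^sup>2)
      = 2 * real CARD('n) * (\<Sum>i\<in>UNIV. (norm (a i))\<^sup>2) - 2 * (\<Sum>i\<in>UNIV. \<Sum>j\<in>UNIV. a i \<bullet> a j)"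
    by (simp add: sum.distrib sum_subtractf sum_distrib_left[symmetric])
  also have "(\<Sum>i\<in>UNIV. \<Sum>j\<in>UNIV. a i \<bullet> a j) = (norm (\<Sum>i\<in>UNIV. a i))\<^sup>2"
    by (simp only: power2_norm_eq_inner inner_sum_left) (simp only: inner_sum_right)
  finally show ?thesis by (simp add: a_def)
qed

text \<open>The law \<open>\<nu>\<close> of the mean \<open>m\<close> of the coordinates of a plan \<open>\<gamma>\<close> is a competitor in the
  barycenter problem, because the joint law of \<open>m x\<close> and \<open>x $ i\<close> couples \<open>\<nu>\<close> with \<open>\<mu> i\<close>.\<close>

lemma barycenter_value_le_multi_cost:
  fixes \<mu> :: "'n::finite \<Rightarrow> 'a::euclidean_space measure"
  assumes \<gamma>: "\<gamma> \<in> multi_couplings \<mu>"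
  obtains \<nu> where "\<nu> \<in> space (prob_algebra borel)"
    "(\<Sum>i\<in>UNIV. (W2 \<nu> (\<mu> i))\<^sup>2) \<le> multi_cost \<gamma> / of_nat (2 * CARD('n))"
proof
  have \<gamma>_prob: "prob_space \<gamma>" and [measurable_cong]: "sets \<gamma> = sets borel"
    and \<mu>: "\<mu> i = distr \<gamma> borel (\<lambda>x. x $ i)" for i
    using \<gamma> by (simp_all add: multi_couplings_def space_prob_algebra)
  define m :: "'a ^ 'n \<Rightarrow> 'a" where "m x = (\<Sum>i\<in>UNIV. x $ i) /\<^sub>R real CARD('n)" for x
  have [measurable]: "m \<in> borel_measurable borel"
    unfolding m_def by measurable
  let ?\<nu> = "distr \<gamma> borel m"
  show "?\<nu> \<in> space (prob_algebra borel)"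
    using \<gamma>_prob by (auto simp: space_prob_algebra intro!: prob_space.prob_space_distr)
  have W2_le: "(W2 ?\<nu> (\<mu> i))\<^sup>2 \<le> (\<integral>\<^sup>+ x. ennreal ((norm (m x - x $ i))\<^sup>2) \<partial>\<gamma>)" for i
  proof -
    let ?\<pi> = "distr \<gamma> borel (\<lambda>x. (m x, x $ i))"
    have "?\<pi> \<in> couplings ?\<nu> (\<mu> i)"
      using \<gamma>_prob unfolding couplings_def \<mu>
      by (auto simp: space_prob_algebra distr_distr o_def borel_prod[symmetric]
          intro!: prob_space.prob_space_distr)
    then have "(W2 ?\<nu> (\<mu> i))\<^sup>2 \<le> (\<integral>\<^sup>+ (x, y). ennreal ((norm (x - y))\<^sup>2) \<partial>?\<pi>)"
      unfolding W2_def ennsqrt_squared by (rule INF_lower)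
    also have "\<dots> = (\<integral>\<^sup>+ x. ennreal ((norm (m x - x $ i))\<^sup>2) \<partial>\<gamma>)"
      by (subst nn_integral_distr) (simp_all add: case_prod_beta borel_prod[symmetric])
    finally show ?thesis .
  qed
  have mean: "(\<Sum>i\<in>UNIV. (norm (m x - x $ i))\<^sup>2)
      = (\<Sum>i\<in>UNIV. \<Sum>j\<in>UNIV. (norm (x $ i - x $ j))\<^sup>2) / real (2 * CARD('n))" for x
  proof -
    have "(\<Sum>i\<in>UNIV. m x - x $ i) = 0"
      by (simp add: sum_subtractf m_def sum_constant_scaleR)
    then show ?thesis
      by (simp add: sum_norm_diff_squares[of "($) x" "m x"])
  qed
  have "(\<Sum>i\<in>UNIV. (W2 ?\<nu> (\<mu> i))\<^sup>2)
      \<le> (\<Sum>i\<in>UNIV. \<integral>\<^sup>+ x. ennreal ((norm (m x - x $ i))\<^sup>2) \<partial>\<gamma>)"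
    by (intro sum_mono W2_le)
  also have "\<dots> = (\<integral>\<^sup>+ x. ennreal (\<Sum>i\<in>UNIV. (norm (m x - x $ i))\<^sup>2) \<partial>\<gamma>)"
    by (simp add: nn_integral_sum[symmetric] sum_ennreal)
  also have "\<dots> = (\<integral>\<^sup>+ x. ennreal (\<Sum>i\<in>UNIV. \<Sum>j\<in>UNIV. (norm (x $ i - x $ j))\<^sup>2)
      / of_nat (2 * CARD('n)) \<partial>\<gamma>)"
    unfolding mean ennreal_of_nat_eq_real_of_nat
    by (intro nn_integral_cong divide_ennreal[symmetric]) (simp_all add: sum_nonneg)
  also have "\<dots> = multi_cost \<gamma> / of_nat (2 * CARD('n))"
    unfolding multi_cost_def by (rule nn_integral_divide) measurable
  finally show "(\<Sum>i\<in>UNIV. (W2 ?\<nu> (\<mu> i))\<^sup>2) \<le> multi_cost \<gamma> / of_nat (2 * CARD('n))" .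
qed

section \<open>Optimal transport between uniform measures on three points\<close>

text \<open>A coupling of two uniform measures is a doubly stochastic matrix, up to scaling. The points
  \<open>y k\<close> may coincide, so the coupling determines the rows of such a matrix only up to
  redistribution among equal points; here the mass of an atom is shared equally among all
  indices that produce it. Repetitions have to be admitted because an element of
  \<^term>\<open>empirical_measures 3\<close> can have fewer than three atoms.\<close>

lemma coupling_of_uniforms:
  fixes x y :: "'k::finite \<Rightarrow> 'a::euclidean_space"
  assumes \<pi>: "\<pi> \<in> couplings (unif y) (unif x)" and x: "inj x"
  obtains w :: "'k \<Rightarrow> 'k \<Rightarrow> real" where
    "\<And>k b. w k b \<ge> 0"
    "\<And>k. (\<Sum>b\<in>UNIV. w k b) = 1 / CARD('k)" "\<And>b. (\<Sum>k\<in>UNIV. w k b) = 1 / CARD('k)"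
    "\<And>g. (\<integral>\<^sup>+ (u, v). ennreal (g u v) \<partial>\<pi>)
           = (\<Sum>k\<in>UNIV. \<Sum>b\<in>UNIV. ennreal (w k b) * ennreal (g (y k) (x b)))"
proof -
  have "prob_space \<pi>" and [measurable_cong]: "sets \<pi> = sets borel"
    and fst: "distr \<pi> borel fst = unif y" and snd: "distr \<pi> borel snd = unif x"
    using \<pi> by (auto simp: couplings_def space_prob_algebra)
  interpret prob_space \<pi> by fact
  have [measurable]: "fst \<in> measurable \<pi> borel" "snd \<in> measurable \<pi> borel"
    by (simp_all add: measurable_cong_sets[OF \<open>sets \<pi> = sets borel\<close> refl] borel_prod[symmetric])
  have [measurable]: "{p} \<in> sets \<pi>" for p
    by simp
  have [simp]: "space \<pi> = UNIV"
    by (metis \<open>sets \<pi> = sets borel\<close> sets_eq_imp_space_eq space_borel)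
  define mult where "mult u = real (card {k. y k = u})" for u
  have mult_pos: "mult (y k) > 0" for k
    by (auto simp: mult_def card_gt_0_iff)
  define w where "w k b = prob {(y k, x b)} / mult (y k)" for k b
  have w_nonneg: "w k b \<ge> 0" for k b
    using mult_pos[of k] by (simp add: w_def)
  have AE: "AE p in \<pi>. p \<in> range y \<times> range x"
  proof -
    have "AE p in \<pi>. fst p \<in> range y"
      by (rule AE_distrD[of fst \<pi> borel]) (simp_all only: fst AE_unif, measurable)
    moreover have "AE p in \<pi>. snd p \<in> range x"
      by (rule AE_distrD[of snd \<pi> borel]) (simp_all only: snd AE_unif, measurable)
    ultimately show ?thesis by eventually_elim (auto simp: mem_Times_iff)
  qed
  have [measurable]: "range y \<times> range x \<in> sets \<pi>"
    unfolding \<open>sets \<pi> = sets borel\<close> by (intro borel_closed finite_imp_closed) simp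
  have spread: "(\<Sum>u\<in>range y. f u) = (\<Sum>k\<in>UNIV. f (y k) / mult (y k))" for f :: "'a \<Rightarrow> real"
  proof -
    have "(\<Sum>k\<in>UNIV. f (y k) / mult (y k)) = (\<Sum>u\<in>range y. \<Sum>k | k \<in> UNIV \<and> y k = u. f (y k) / mult (y k))"
      by (rule sum.image_gen) simp
    also have "\<dots> = (\<Sum>u\<in>range y. f u)"
    proof (rule sum.cong[OF refl])
      fix u assume "u \<in> range y"
      then have "mult u > 0" using mult_pos by auto
      have "(\<Sum>k | k \<in> UNIV \<and> y k = u. f (y k) / mult (y k)) = (\<Sum>k | y k = u. f u / mult u)"
        by (intro sum.cong) auto
      also have "\<dots> = f u" using \<open>mult u > 0\<close> by (simp flip: mult_def)
      finally show "(\<Sum>k | k \<in> UNIV \<and> y k = u. f (y k) / mult (y k)) = f u" .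
    qed
    finally show ?thesis by simp
  qed
  have measure_eq: "prob A = (\<Sum>u\<in>range y. \<Sum>b\<in>UNIV. prob {(u, x b)} * indicator A (u, x b))"
    if [measurable]: "A \<in> sets \<pi>" for A
  proof -
    have "prob A = prob (A \<inter> range y \<times> range x)"
      using AE by (intro measure_eq_AE) (auto intro: sets.Int)
    also have "\<dots> = (\<Sum>p\<in>A \<inter> range y \<times> range x. prob {p})"
      by (intro finite_measure_eq_sum_singleton) auto
    also have "\<dots> = (\<Sum>p\<in>range y \<times> range x. prob {p} * indicator A p)"
      by (intro sum.mono_neutral_cong_left) (auto simp: indicator_def)
    also have "\<dots> = (\<Sum>u\<in>range y. \<Sum>v\<in>range x. prob {(u, v)} * indicator A (u, v))"
      by (simp only: sum.cartesian_product' fst_conv snd_conv)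
    finally show ?thesis
      by (simp only: sum.reindex[OF x] o_def)
  qed
  show ?thesis
  proof
    show "w k b \<ge> 0" for k b by (rule w_nonneg)
  next
    fix k
    have "prob (fst -` {y k}) = mult (y k) / CARD('k)"
    proof -
      have "prob (fst -` {y k}) = measure (unif y) {y k}"
        unfolding fst[symmetric] by (subst measure_distr) auto
      also have "\<dots> = mult (y k) / CARD('k)"
      proof -
        have "(\<Sum>j\<in>UNIV. indicator {y k} (y j)) = ennreal (mult (y k))"
          by (simp add: mult_def indicator_def sum.If_cases ennreal_of_nat_eq_real_of_nat)
        then show ?thesis
          using mult_pos[of k]
          by (simp add: measure_def emeasure_unif ennreal_of_nat_eq_real_of_nat divide_ennreal)
      qed
      finally show ?thesis .
    qed
    moreover have "prob (fst -` {y k}) = (\<Sum>b\<in>UNIV. prob {(y k, x b)})"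
    proof -
      have "fst -` {y k} \<in> sets \<pi>"
        using measurable_sets[of fst \<pi> borel "{y k}"] by simp
      then have "prob (fst -` {y k}) = (\<Sum>u\<in>range y. \<Sum>b\<in>UNIV. prob {(u, x b)} * indicator {y k} u)"
        by (subst measure_eq) (auto intro!: sum.cong simp: indicator_def)
      also have "\<dots> = (\<Sum>u\<in>range y. if u = y k then (\<Sum>b\<in>UNIV. prob {(u, x b)}) else 0)"
        by (intro sum.cong) auto
      finally show ?thesis by simp
    qed
    ultimately show "(\<Sum>b\<in>UNIV. w k b) = 1 / CARD('k)"
      using mult_pos[of k] by (simp add: w_def sum_divide_distrib[symmetric])
  next
    fix b
    have "prob (snd -` {x b}) = measure (unif x) {x b}"
      unfolding snd[symmetric] by (subst measure_distr) auto
    also have "\<dots> = 1 / CARD('k)"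
    proof -
      have "(\<Sum>j\<in>UNIV. indicator {x b} (x j)) = (1 :: ennreal)"
        using x by (simp add: indicator_def sum.If_cases inj_eq)
      then show ?thesis
        by (simp add: measure_def emeasure_unif ennreal_of_nat_eq_real_of_nat divide_ennreal
            flip: ennreal_1)
    qed
    finally have "prob (snd -` {x b}) = 1 / CARD('k)" .
    moreover have "prob (snd -` {x b}) = (\<Sum>u\<in>range y. prob {(u, x b)})"
    proof -
      have "snd -` {x b} \<in> sets \<pi>"
        using measurable_sets[of snd \<pi> borel "{x b}"] by simp
      then have "prob (snd -` {x b}) = (\<Sum>u\<in>range y. \<Sum>c\<in>UNIV. if c = b then prob {(u, x c)} else 0)"
        using x by (subst measure_eq) (auto intro!: sum.cong simp: indicator_def inj_eq)
      then show ?thesis by simp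
    qed
    ultimately show "(\<Sum>k\<in>UNIV. w k b) = 1 / CARD('k)"
      by (simp add: spread w_def)
  next
    fix g :: "'a \<Rightarrow> 'a \<Rightarrow> real"
    have "(\<integral>\<^sup>+ (u, v). ennreal (g u v) \<partial>\<pi>)
        = (\<integral>\<^sup>+ p. (\<Sum>q\<in>range y \<times> range x. ennreal (max 0 (g (fst q) (snd q))) * indicator {q} p) \<partial>\<pi>)"
      using AE
      by (intro nn_integral_cong_AE, eventually_elim)
         (auto simp: indicator_def if_distrib[of "(*) _"] sum.If_cases case_prod_beta ennreal_max_0 cong: if_cong)
    also have "\<dots> = (\<Sum>q\<in>range y \<times> range x. ennreal (max 0 (g (fst q) (snd q))) * emeasure \<pi> {q})"
      by (subst nn_integral_sum) (simp_all add: nn_integral_cmult_indicator)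
    also have "\<dots> = ennreal (\<Sum>q\<in>range y \<times> range x. max 0 (g (fst q) (snd q)) * prob {q})"
      by (simp add: emeasure_eq_measure ennreal_mult sum_ennreal[symmetric])
    also have "(\<Sum>q\<in>range y \<times> range x. max 0 (g (fst q) (snd q)) * prob {q})
        = (\<Sum>u\<in>range y. \<Sum>v\<in>range x. max 0 (g u v) * prob {(u, v)})"
      by (simp only: sum.cartesian_product' fst_conv snd_conv)
    also have "\<dots> = (\<Sum>u\<in>range y. \<Sum>b\<in>UNIV. max 0 (g u (x b)) * prob {(u, x b)})"
      by (simp only: sum.reindex[OF x] o_def)
    also have "\<dots> = (\<Sum>k\<in>UNIV. \<Sum>b\<in>UNIV. w k b * max 0 (g (y k) (x b)))"
      by (simp add: spread w_def sum_divide_distrib mult.commute)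
    also have "ennreal \<dots> = (\<Sum>k\<in>UNIV. \<Sum>b\<in>UNIV. ennreal (w k b) * ennreal (g (y k) (x b)))"
      by (simp add: w_nonneg sum_nonneg ennreal_mult ennreal_max_0 flip: sum_ennreal)
    finally show "(\<integral>\<^sup>+ (u, v). ennreal (g u v) \<partial>\<pi>)
      = (\<Sum>k\<in>UNIV. \<Sum>b\<in>UNIV. ennreal (w k b) * ennreal (g (y k) (x b)))" .
  qed
qed

lemma bij_3_of_distinct:
  fixes a b c :: 3
  assumes "a \<noteq> b" "a \<noteq> c" "b \<noteq> c"
  obtains \<sigma> :: "3 \<Rightarrow> 3" where "bij \<sigma>" "\<sigma> 1 = a" "\<sigma> 2 = b" "\<sigma> 3 = c"
proof -
  define \<sigma> :: "3 \<Rightarrow> 3" where "\<sigma> k = (if k = 1 then a else if k = 2 then b else c)" for k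
  have vals: "\<sigma> 1 = a" "\<sigma> 2 = b" "\<sigma> 3 = c"
    by (simp_all add: \<sigma>_def)
  have "inj \<sigma>"
    unfolding inj_def forall_3 vals using assms by auto
  then have "bij \<sigma>"
    by (simp add: bij_def finite_UNIV_inj_surj)
  with vals show ?thesis by (intro that)
qed

text \<open>Birkhoff's theorem for \<open>3\<times>3\<close> matrices, in the form in which it bounds a linear functional.
  Every entry of a \<open>3\<times>3\<close> matrix belongs to exactly one even and one odd permutation, so once the
  weight \<open>z\<close> of the identity is chosen, the diagonal fixes the weights \<open>r1\<close>, \<open>r2\<close>, \<open>r3\<close> of the
  transpositions, and the entries off the diagonal fix the weights \<open>p\<close> and \<open>q\<close> of the two
  3-cycles. With the largest admissible \<open>z\<close>, the least diagonal entry, one transposition gets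
  weight zero, hence \<open>p\<close> and \<open>q\<close> are equal to entries of the matrix and so are nonnegative.\<close>

lemma assignment_le_doubly_stochastic:
  fixes w m :: "3 \<Rightarrow> 3 \<Rightarrow> real"
  assumes nonneg: "\<And>k b. w k b \<ge> 0"
    and row: "\<And>k. (\<Sum>b\<in>UNIV. w k b) = t" and col: "\<And>b. (\<Sum>k\<in>UNIV. w k b) = t"
    and L: "\<And>\<sigma>. bij \<sigma> \<Longrightarrow> L \<le> (\<Sum>k\<in>UNIV. m k (\<sigma> k))"
  shows "t * L \<le> (\<Sum>k\<in>UNIV. \<Sum>b\<in>UNIV. w k b * m k b)"
proof -
  have L': "L \<le> m 1 a + m 2 b + m 3 c" if abc: "a \<noteq> b" "a \<noteq> c" "b \<noteq> c" for a b c
  proof -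
    obtain \<sigma> :: "3 \<Rightarrow> 3" where "bij \<sigma>" and \<sigma>: "\<sigma> 1 = a" "\<sigma> 2 = b" "\<sigma> 3 = c"
      using abc by (rule bij_3_of_distinct)
    then show ?thesis using L[of \<sigma>] unfolding sum_3 \<sigma> by simp
  qed
  have r: "w k 1 + w k 2 + w k 3 = t" and c: "w 1 k + w 2 k + w 3 k = t" for k
    using row[of k] col[of k] by (simp_all add: sum_3)
  define z where "z = min (w 1 1) (min (w 2 2) (w 3 3))"
  define p where "p = w 1 2 - w 3 3 + z"
  define q where "q = w 1 3 - w 2 2 + z"
  define r1 where "r1 = w 1 1 - z"
  define r2 where "r2 = w 2 2 - z"
  define r3 where "r3 = w 3 3 - z"
  note defs = p_def q_def r1_def r2_def r3_def
  note eqs = r[of 1] r[of 2] r[of 3] c[of 1] c[of 2] c[of 3]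
  have pos: "z \<ge> 0" "r1 \<ge> 0" "r2 \<ge> 0" "r3 \<ge> 0" "p \<ge> 0" "q \<ge> 0"
    using nonneg[of 1 1] nonneg[of 2 2] nonneg[of 3 3] nonneg[of 1 2] nonneg[of 1 3]
      nonneg[of 2 3] nonneg[of 3 1] nonneg[of 3 2] nonneg[of 2 1] eqs
    unfolding defs z_def min_def by (auto split: if_splits)
  have w: "w 1 1 = z + r1" "w 2 2 = z + r2" "w 3 3 = z + r3"
    "w 1 2 = p + r3" "w 2 3 = p + r1" "w 3 1 = p + r2"
    "w 1 3 = q + r2" "w 2 1 = q + r3" "w 3 2 = q + r1"
    and t: "t = z + p + q + r1 + r2 + r3"
    using eqs unfolding defs by linarith+
  have "t * L = z * L + p * L + q * L + r1 * L + r2 * L + r3 * L"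
    unfolding t by (simp add: algebra_simps)
  also have "\<dots> \<le> z * (m 1 1 + m 2 2 + m 3 3) + p * (m 1 2 + m 2 3 + m 3 1)
      + q * (m 1 3 + m 2 1 + m 3 2) + r1 * (m 1 1 + m 2 3 + m 3 2)
      + r2 * (m 1 3 + m 2 2 + m 3 1) + r3 * (m 1 2 + m 2 1 + m 3 3)"
    by (intro add_mono mult_left_mono pos L') simp_all
  also have "\<dots> = (\<Sum>k\<in>UNIV. \<Sum>b\<in>UNIV. w k b * m k b)"
    unfolding sum_3 w by (simp add: algebra_simps)
  finally show ?thesis .
qed

text \<open>The transport problem between two uniform measures on three points has a solution that sends
  points to points, since its linear cost is minimized at a permutation matrix.\<close>

lemma W2_unif_ge_assignment:
  fixes x y :: "3 \<Rightarrow> 'a::euclidean_space"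
  assumes x: "inj x"
  obtains \<sigma> where "bij \<sigma>"
    "ennreal ((\<Sum>k\<in>UNIV. (norm (y k - x (\<sigma> k)))\<^sup>2) / 3) \<le> (W2 (unif y) (unif x))\<^sup>2"
proof -
  let ?A = "\<lambda>\<sigma>. \<Sum>k\<in>UNIV. (norm (y k - x (\<sigma> k)))\<^sup>2"
  define \<sigma> where "\<sigma> = arg_min_on ?A {\<sigma>. bij \<sigma>}"
  have *: "finite {\<sigma> :: 3 \<Rightarrow> 3. bij \<sigma>}" "{\<sigma> :: 3 \<Rightarrow> 3. bij \<sigma>} \<noteq> {}"
    using bij_id by (auto intro!: exI[of _ id])
  have "bij \<sigma>"
    using arg_min_if_finite(1)[OF *, of ?A] by (simp add: \<sigma>_def)
  have min: "?A \<sigma> \<le> ?A \<tau>" if "bij \<tau>" for \<tau>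
    unfolding \<sigma>_def by (rule arg_min_least[OF *]) (simp add: that)
  have "ennreal (?A \<sigma> / 3) \<le> (\<integral>\<^sup>+ (u, v). ennreal ((norm (u - v))\<^sup>2) \<partial>\<pi>)"
    if \<pi>: "\<pi> \<in> couplings (unif y) (unif x)" for \<pi>
  proof -
    obtain w :: "3 \<Rightarrow> 3 \<Rightarrow> real" where w: "\<And>k b. w k b \<ge> 0"
      "\<And>k. (\<Sum>b\<in>UNIV. w k b) = 1 / CARD(3)" "\<And>b. (\<Sum>k\<in>UNIV. w k b) = 1 / CARD(3)"
      and int: "\<And>g. (\<integral>\<^sup>+ (u, v). ennreal (g u v) \<partial>\<pi>)
           = (\<Sum>k\<in>UNIV. \<Sum>b\<in>UNIV. ennreal (w k b) * ennreal (g (y k) (x b)))"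
      by (rule coupling_of_uniforms[OF \<pi> x]) (rule that)
    have "1 / CARD(3) * ?A \<sigma> \<le> (\<Sum>k\<in>UNIV. \<Sum>b\<in>UNIV. w k b * (norm (y k - x b))\<^sup>2)"
      by (rule assignment_le_doubly_stochastic[OF w min])
    then have "ennreal (?A \<sigma> / 3) \<le> ennreal (\<Sum>k\<in>UNIV. \<Sum>b\<in>UNIV. w k b * (norm (y k - x b))\<^sup>2)"
      by (intro ennreal_leI) simp
    also have "\<dots> = (\<integral>\<^sup>+ (u, v). ennreal ((norm (u - v))\<^sup>2) \<partial>\<pi>)"
      unfolding int using w(1) by (simp add: sum_nonneg ennreal_mult flip: sum_ennreal)
    finally show ?thesis .
  qed
  then have "ennreal (?A \<sigma> / 3) \<le> (W2 (unif y) (unif x))\<^sup>2"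
    unfolding W2_def ennsqrt_squared by (intro INF_greatest)
  with \<open>bij \<sigma>\<close> show ?thesis by (rule that)
qed

section \<open>The finite problem given by the nine points\<close>

lemma marg_unif: "marg i = unif (($) (pt $ i))"
  unfolding marg_def by (rule emp_3)

lemma perm_plan_unif: "perm_plan \<sigma> \<tau> = unif (\<lambda>k. xx k (\<sigma> k) (\<tau> k))"
  unfolding perm_plan_def using emp_3[of "\<lambda>k. xx k (\<sigma> k) (\<tau> k)"] by simp

lemma xx_nth [simp]: "xx a b e $ 1 = pt $ 1 $ a" "xx a b e $ 2 = pt $ 2 $ b" "xx a b e $ 3 = pt $ 3 $ e"
  by (simp_all add: xx_def)

lemma pt_inj: "inj (($) (pt $ i))"
proof -
  have "\<forall>i. inj (($) (pt $ i))"
    unfolding inj_def forall_3 by (simp add: pt_def vec_eq_iff forall_2)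
  then show ?thesis by blast
qed

lemma xx_eq_iff: "xx a b e = xx a' b' e' \<longleftrightarrow> a = a' \<and> b = b' \<and> e = e'"
  by (simp add: vec_eq_iff[of "xx a b e"] forall_3 inj_eq[OF pt_inj])

definition cost :: "3 \<Rightarrow> 3 \<Rightarrow> 3 \<Rightarrow> real" where
  "cost a b e = (\<Sum>i\<in>UNIV. \<Sum>j\<in>UNIV. (norm (xx a b e $ i - xx a b e $ j))\<^sup>2)"

lemma cost_pairwise:
  "cost a b e = 2 * ((norm (pt $ 1 $ a - pt $ 2 $ b))\<^sup>2 + (norm (pt $ 1 $ a - pt $ 3 $ e))\<^sup>2
     + (norm (pt $ 2 $ b - pt $ 3 $ e))\<^sup>2)"
  by (simp add: cost_def sum_3 norm_minus_commute)

lemma norm_sq_2: "(norm (v :: real ^ 2))\<^sup>2 = (v $ 1)\<^sup>2 + (v $ 2)\<^sup>2"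
  by (simp only: power2_norm_eq_inner) (simp add: inner_vec_def sum_2 power2_eq_square)

lemma cost_table:
  "cost 1 1 1 = 138.5067694364" "cost 1 1 2 = 64.2613" "cost 1 1 3 = 37.55275248"
  "cost 1 2 1 = 234.1781881724" "cost 1 2 2 = 58.86746512" "cost 1 2 3 = 98.01471648"
  "cost 1 3 1 = 225.5774079004" "cost 1 3 2 = 59.04548744" "cost 1 3 3 = 95.47755832"
  "cost 2 1 1 = 121.809002806" "cost 2 1 2 = 121.6868445296" "cost 2 1 3 = 88.9317709456"
  "cost 2 2 1 = 185.526787486" "cost 2 2 2 = 84.3393755936" "cost 2 2 3 = 117.4401008896"
  "cost 2 3 1 = 168.296705798" "cost 2 3 2 = 75.8880964976" "cost 2 3 3 = 106.2736413136"
  "cost 3 1 1 = 314.5678309924" "cost 3 1 2 = 314.52002932" "cost 3 1 3 = 303.33726224"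
  "cost 3 2 1 = 307.0914613684" "cost 3 2 2 = 205.97840608" "cost 3 2 3 = 260.65143788"
  "cost 3 3 1 = 286.4976274564" "cost 3 3 2 = 194.16337476" "cost 3 3 3 = 246.12122608"
  unfolding cost_pairwise norm_sq_2 vector_minus_component
  by (simp_all add: pt_def power2_eq_square)

lemma cost_nonneg: "cost a b e \<ge> 0"
  by (simp add: cost_def sum_nonneg)

lemma multi_cost_emp:
  assumes "xs \<noteq> []"
  shows "multi_cost (emp (map (\<lambda>(a, b, e). xx a b e) xs))
    = ennreal ((\<Sum>(a, b, e)\<leftarrow>xs. cost a b e) / real (length xs))"
proof -
  have nonneg: "(\<Sum>(a, b, e)\<leftarrow>ys. cost a b e) \<ge> 0" for ys
    by (auto intro!: sum_list_nonneg simp: cost_nonneg)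
  have "(\<Sum>(a, b, e)\<leftarrow>xs. ennreal (cost a b e)) = ennreal (\<Sum>(a, b, e)\<leftarrow>xs. cost a b e)"
    by (induction xs) (auto simp: cost_nonneg nonneg)
  then show ?thesis
    using assms nonneg[of xs] unfolding multi_cost_def
    by (subst nn_integral_emp)
      (simp_all add: o_def case_prod_unfold flip: cost_def divide_ennreal ennreal_of_nat_eq_real_of_nat)
qed

lemma multi_cost_perm_plan:
  "multi_cost (perm_plan \<sigma> \<tau>) = ennreal ((\<Sum>k\<in>UNIV. cost k (\<sigma> k) (\<tau> k)) / 3)"
  using multi_cost_emp[of "map (\<lambda>k. (k, \<sigma> k, \<tau> k)) [1, 2, 3]"]
  by (simp add: perm_plan_def sum_3 add.assoc)

abbreviation split_plan :: "(real ^ 2 ^ 3) measure" where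
  "split_plan \<equiv> emp [xx 1 1 3, xx 1 2 2, xx 2 1 1, xx 2 2 3, xx 3 3 1, xx 3 3 2]"

lemma multi_cost_split_plan: "multi_cost split_plan = ennreal (816.330323512 / 6)"
  using multi_cost_emp[of "[(1,1,3), (1,2,2), (2,1,1), (2,2,3), (3,3,1), (3,3,2)]"]
  by (simp add: cost_table)

lemma bij_3_cases:
  assumes "bij (\<sigma> :: 3 \<Rightarrow> 3)"
  shows "\<sigma> 1 = 1 \<and> \<sigma> 2 = 2 \<and> \<sigma> 3 = 3 \<or> \<sigma> 1 = 1 \<and> \<sigma> 2 = 3 \<and> \<sigma> 3 = 2 \<or>
     \<sigma> 1 = 2 \<and> \<sigma> 2 = 1 \<and> \<sigma> 3 = 3 \<or> \<sigma> 1 = 2 \<and> \<sigma> 2 = 3 \<and> \<sigma> 3 = 1 \<or>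
     \<sigma> 1 = 3 \<and> \<sigma> 2 = 1 \<and> \<sigma> 3 = 2 \<or> \<sigma> 1 = 3 \<and> \<sigma> 2 = 2 \<and> \<sigma> 3 = 1"
proof -
  have "inj \<sigma>" using assms by (rule bij_is_inj)
  then have "\<sigma> 1 \<noteq> \<sigma> 2" "\<sigma> 1 \<noteq> \<sigma> 3" "\<sigma> 2 \<noteq> \<sigma> 3"
    by (simp_all add: inj_eq)
  then show ?thesis
    using exhaust_3[of "\<sigma> 1"] exhaust_3[of "\<sigma> 2"] exhaust_3[of "\<sigma> 3"] by metis
qed

lemma perm_cost_ge:
  assumes "bij \<sigma>" "bij \<tau>"
  shows "cost 1 1 3 + cost 2 2 2 + cost 3 3 1 \<le> (\<Sum>k\<in>UNIV. cost k (\<sigma> k) (\<tau> k))"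
  using bij_3_cases[OF assms(1)] bij_3_cases[OF assms(2)]
  unfolding sum_3 by (elim disjE conjE) (simp_all add: cost_table)

lemma split_plan_coupling: "split_plan \<in> multi_couplings marg"
proof -
  \<comment> \<open>In each coordinate every point of the marginal occurs exactly twice, in one of three orders.\<close>
  have *: "emp [p, p, q, q, r, r] = emp [p, q, r]" for p q r :: "real ^ 2"
  proof (rule measure_eqI)
    fix A assume "A \<in> sets (emp [p, p, q, q, r, r])"
    moreover have "4 / 6 = (2 / 3 :: ennreal)" "2 / 6 = (1 / 3 :: ennreal)"
      using divide_ennreal[of 4 6] divide_ennreal[of 2 3] divide_ennreal[of 2 6] divide_ennreal[of 1 3]
      by simp_all
    ultimately show "emeasure (emp [p, p, q, q, r, r]) A = emeasure (emp [p, q, r]) A"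
      by (simp add: emeasure_emp indicator_def)
  qed simp
  have perm: "emp [p, q, p, q, r, r] = emp [p, p, q, q, r, r]" "emp [r, q, p, r, p, q] = emp [p, p, q, q, r, r]" for p q r :: "real ^ 2"
    by (rule measure_eqI; simp add: emeasure_emp add_ac)+
  have "distr split_plan borel (\<lambda>x. x $ i) = marg i" for i
    using exhaust_3[of i] by (auto simp: distr_emp marg_def * perm)
  then show ?thesis
    by (simp add: multi_couplings_def emp_prob)
qed

text \<open>A solution of the dual linear program. Complementary slackness demands equality in
  \<open>potential_feasible\<close> at the six atoms of \<^term>\<open>split_plan\<close>. After the normalization
  \<open>potential 1 1 = potential 2 1 = 0\<close> these equations determine all values except for a trade-off
  between \<open>potential 1 3\<close> and \<open>potential 2 3\<close>. The remaining inequalities confine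
  \<open>potential 2 3\<close> to a short interval, which contains \<open>43\<close>. With this normalization all values
  are nonnegative, as weak duality in \<^typ>\<open>ennreal\<close> requires.\<close>

definition potential :: "3 \<Rightarrow> 3 \<Rightarrow> real" where
  "potential i a = (vector [vector [0, 25.2473166996, 146.93594135],
     vector [0, 54.64003171, 43],
     vector [96.5616861064, 4.22743341, 37.55275248]] :: real ^ 3 ^ 3) $ i $ a"

lemma potential_nonneg: "potential i a \<ge> 0"
proof -
  have "\<forall>i a. potential i a \<ge> 0"
    unfolding forall_3 by (simp add: potential_def)
  then show ?thesis by blast
qed

lemma potential_feasible: "potential 1 a + potential 2 b + potential 3 e \<le> cost a b e"
proof -
  have "\<forall>a b e. potential 1 a + potential 2 b + potential 3 e \<le> cost a b e"
    unfolding forall_3 by (simp add: potential_def cost_table)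
  then show ?thesis by blast
qed

lemma marg_couplings_support:
  assumes \<gamma>: "\<gamma> \<in> multi_couplings marg"
  shows "AE x in \<gamma>. \<exists>a b e. x = xx a b e"
proof -
  have [measurable_cong]: "sets \<gamma> = sets borel"
    using \<gamma> by (simp add: multi_couplings_def space_prob_algebra)
  have marg: "distr \<gamma> borel (\<lambda>x. x $ i) = marg i" for i
    using \<gamma> by (simp add: multi_couplings_def)
  have "AE x in \<gamma>. x $ i \<in> range (($) (pt $ i))" for i
    by (rule AE_distrD[of "\<lambda>x. x $ i" \<gamma> borel]) (measurable, simp only: marg marg_unif AE_unif)
  from this[of 1] this[of 2] this[of 3] show ?thesis
    by eventually_elim (auto simp: vec_eq_iff forall_3)
qed

text \<open>Weak duality, with each potential extended by zero outside the three points of its marginal.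
  The bound is the cost of \<^term>\<open>split_plan\<close>.\<close>

lemma multi_cost_marg_ge:
  assumes \<gamma>: "\<gamma> \<in> multi_couplings marg"
  shows "ennreal (816.330323512 / 6) \<le> multi_cost \<gamma>"
proof -
  define \<phi> :: "3 \<Rightarrow> real ^ 2 \<Rightarrow> ennreal"
    where "\<phi> i y = (\<Sum>a\<in>UNIV. ennreal (potential i a) * indicator {pt $ i $ a} y)" for i y
  have [measurable]: "\<phi> i \<in> borel_measurable borel" for i
    unfolding \<phi>_def by measurable
  have \<phi>_pt: "\<phi> i (pt $ i $ a) = ennreal (potential i a)" for i a
  proof -
    have "\<phi> i (pt $ i $ a) = (\<Sum>b\<in>UNIV. if b = a then ennreal (potential i b) else 0)"
      unfolding \<phi>_def by (intro sum.cong) (auto simp: indicator_def inj_eq[OF pt_inj])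
    then show ?thesis by simp
  qed
  have "(\<integral>\<^sup>+ y. \<phi> i y \<partial>marg i) = ennreal ((\<Sum>a\<in>UNIV. potential i a) / 3)" for i
    unfolding marg_unif
    by (simp add: nn_integral_unif \<phi>_pt sum_ennreal potential_nonneg sum_nonneg flip: divide_ennreal)
  then have "(\<Sum>i\<in>UNIV. \<integral>\<^sup>+ y. \<phi> i y \<partial>marg i) = ennreal (\<Sum>i\<in>UNIV. (\<Sum>a\<in>UNIV. potential i a) / 3)"
    by (simp add: sum_ennreal potential_nonneg sum_nonneg)
  also have "(\<Sum>i\<in>UNIV. (\<Sum>a\<in>UNIV. potential i a) / 3) = 816.330323512 / 6"
    by (simp add: sum_3 potential_def)
  finally have "(\<Sum>i\<in>UNIV. \<integral>\<^sup>+ y. \<phi> i y \<partial>marg i) = ennreal (816.330323512 / 6)" .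
  moreover have "(\<Sum>i\<in>UNIV. \<integral>\<^sup>+ y. \<phi> i y \<partial>marg i) \<le> multi_cost \<gamma>"
  proof (rule multi_coupling_weak_duality[OF \<gamma>])
    have "(\<Sum>i\<in>UNIV. \<phi> i (xx a b e $ i)) \<le> ennreal (cost a b e)" for a b e
    proof -
      have "(\<Sum>i\<in>UNIV. \<phi> i (xx a b e $ i)) = ennreal (potential 1 a + potential 2 b + potential 3 e)"
        by (simp add: sum_3 \<phi>_pt potential_nonneg)
      then show ?thesis
        using potential_feasible by (simp add: ennreal_leI)
    qed
    note this[unfolded cost_def]
    then show "AE x in \<gamma>. (\<Sum>i\<in>UNIV. \<phi> i (x $ i)) \<le> ennreal (\<Sum>i\<in>UNIV. \<Sum>j\<in>UNIV. (norm (x $ i - x $ j))\<^sup>2)"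
      using marg_couplings_support[OF \<gamma>] by (auto elim!: eventually_mono)
  qed measurable
  ultimately show ?thesis by simp
qed

text \<open>Each point of the first marginal has positive mass, so the maps of the graph send it to points
  of the other two marginals; this defines \<open>\<sigma>\<close> and \<open>\<tau>\<close>. A measure on a graph is the image of its
  first marginal. Finally \<open>\<sigma>\<close> and \<open>\<tau>\<close> are onto, hence bijective, because no point of the second
  and third marginal may lose its mass.\<close>

lemma graph_coupling_is_perm_plan:
  assumes \<gamma>: "\<gamma> \<in> multi_couplings marg" and graph: "concentrated_on_graph \<gamma>"
  obtains \<sigma> \<tau> where "bij \<sigma>" "bij \<tau>" "\<gamma> = perm_plan \<sigma> \<tau>"
proof -
  have sets [measurable_cong]: "sets \<gamma> = sets borel"
    using \<gamma> by (simp add: multi_couplings_def space_prob_algebra)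
  have marg: "distr \<gamma> borel (\<lambda>x. x $ i) = marg i" for i
    using \<gamma> by (simp add: multi_couplings_def)
  obtain T2 T3 where T: "AE x in \<gamma>. x $ 2 = T2 (x $ 1) \<and> x $ 3 = T3 (x $ 1)"
    using graph by (auto simp: concentrated_on_graph_def)
  have "\<exists>b e. T2 (pt $ 1 $ a) = pt $ 2 $ b \<and> T3 (pt $ 1 $ a) = pt $ 3 $ e" for a
  proof (rule ccontr)
    assume no: "\<not> ?thesis"
    have "AE x in \<gamma>. x $ 1 \<noteq> pt $ 1 $ a"
      using T marg_couplings_support[OF \<gamma>]
    proof eventually_elim
      case (elim x)
      then show ?case using no by (metis xx_nth)
    qed
    then have "AE y in distr \<gamma> borel (\<lambda>x. x $ 1). y \<noteq> pt $ 1 $ a"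
      by (subst AE_distr_iff) (simp_all, measurable)
    then have "emeasure (marg 1) {pt $ 1 $ a} = 0"
      unfolding marg by (subst (asm) AE_iff_measurable[OF _ refl]) (simp_all add: marg_unif)
    then show False
      using emeasure_unif_singleton_pos[of "($) (pt $ 1)" "pt $ 1 $ a"] by (simp add: marg_unif)
  qed
  then obtain \<sigma> \<tau> where \<sigma>\<tau>: "\<And>a. T2 (pt $ 1 $ a) = pt $ 2 $ \<sigma> a" "\<And>a. T3 (pt $ 1 $ a) = pt $ 3 $ \<tau> a"
    by metis
  \<comment> \<open>Only the values at the three points of the first marginal matter; this extension is Borel, which \<open>T2\<close> and \<open>T3\<close> need not be.\<close>
  define G :: "real ^ 2 \<Rightarrow> real ^ 2 ^ 3" where
    "G y = (if y = pt $ 1 $ 1 then xx 1 (\<sigma> 1) (\<tau> 1)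
       else if y = pt $ 1 $ 2 then xx 2 (\<sigma> 2) (\<tau> 2) else xx 3 (\<sigma> 3) (\<tau> 3))" for y
  have [measurable]: "G \<in> borel_measurable borel"
    unfolding G_def by measurable
  have G: "G (pt $ 1 $ k) = xx k (\<sigma> k) (\<tau> k)" for k
    using exhaust_3[of k] by (auto simp: G_def inj_eq[OF pt_inj])
  have "AE x in \<gamma>. x = G (x $ 1)"
    using T marg_couplings_support[OF \<gamma>]
  proof eventually_elim
    case (elim x)
    then obtain a b e where "x = xx a b e" by blast
    with elim have "b = \<sigma> a" "e = \<tau> a"
      by (simp_all add: \<sigma>\<tau> inj_eq[OF pt_inj])
    with \<open>x = xx a b e\<close> show ?case by (simp add: G)
  qed
  have "\<gamma> = distr \<gamma> borel (\<lambda>x. x)"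
    by (simp add: distr_id2 sets)
  also have "\<dots> = distr \<gamma> borel (\<lambda>x. G (x $ 1))"
    by (intro distr_cong_AE) (auto simp: sets \<open>AE x in \<gamma>. x = G (x $ 1)\<close> measurable_ident_sets)
  also have "\<dots> = distr (distr \<gamma> borel (\<lambda>x. x $ 1)) borel G"
    by (subst distr_distr) (auto simp: o_def)
  also have "\<dots> = perm_plan \<sigma> \<tau>"
    by (simp add: marg marg_unif distr_unif G perm_plan_unif)
  finally have plan: "\<gamma> = perm_plan \<sigma> \<tau>" .
  have bij: "bij \<rho>" if "\<And>k. xx k (\<sigma> k) (\<tau> k) $ i = pt $ i $ \<rho> k" for \<rho> i
  proof -
    have "marg i = unif (\<lambda>k. pt $ i $ \<rho> k)"
      using marg[of i] unfolding plan perm_plan_unif by (simp add: distr_unif that)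
    then have "range (($) (pt $ i)) = range (\<lambda>k. pt $ i $ \<rho> k)"
      unfolding marg_unif by (rule range_eq_if_unif_eq)
    then have "surj \<rho>"
      by (metis (no_types) image_image inj_image_eq_iff pt_inj)
    then show ?thesis
      by (simp add: bij_def finite_UNIV_surj_inj)
  qed
  show ?thesis
    by (rule that[OF bij[of 2] bij[of 3] plan]) simp_all
qed

text \<open>Each squared distance is bounded below by an assignment \<open>\<sigma> i\<close> of the points of \<open>marg i\<close> to the
  points \<open>y k\<close>. Summed over \<open>i\<close>, the squares around one \<open>y k\<close> are at least a sixth of the cost of
  the triple assigned to \<open>y k\<close>. The three triples form a permutation plan, whose cost is at
  least that of the best one.\<close>

lemma empirical_barycenter_value_ge:
  assumes "\<nu> \<in> empirical_measures 3"
  shows "ennreal (408.38975553 / 18) \<le> (\<Sum>i\<in>UNIV. (W2 \<nu> (marg i))\<^sup>2)"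
proof -
  obtain ys where "\<nu> = emp ys" "length ys = 3"
    using assms by (auto simp: empirical_measures_def)
  from this(2) have "length ys = Suc (Suc (Suc 0))" by simp
  then obtain y1 y2 y3 where "ys = [y1, y2, y3]"
    by (auto simp only: length_Suc_conv length_0_conv)
  with \<open>\<nu> = emp ys\<close> have ys: "\<nu> = emp [y1, y2, y3]" by simp
  define y :: "3 \<Rightarrow> real ^ 2" where "y k = (vector [y1, y2, y3] :: real ^ 2 ^ 3) $ k" for k
  have \<nu>: "\<nu> = unif y"
    unfolding ys emp_3[of y, symmetric] by (simp add: y_def)
  have "\<exists>\<sigma>. bij \<sigma> \<and> ennreal ((\<Sum>k\<in>UNIV. (norm (y k - pt $ i $ \<sigma> k))\<^sup>2) / 3) \<le> (W2 \<nu> (marg i))\<^sup>2" for i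
  proof -
    obtain \<sigma> where "bij \<sigma>" "ennreal ((\<Sum>k\<in>UNIV. (norm (y k - pt $ i $ \<sigma> k))\<^sup>2) / 3)
        \<le> (W2 (unif y) (unif (($) (pt $ i))))\<^sup>2"
      by (rule W2_unif_ge_assignment[OF pt_inj])
    then show ?thesis unfolding \<nu> marg_unif by blast
  qed
  then have "\<exists>\<sigma>. \<forall>i. bij (\<sigma> i) \<and>
      ennreal ((\<Sum>k\<in>UNIV. (norm (y k - pt $ i $ \<sigma> i k))\<^sup>2) / 3) \<le> (W2 \<nu> (marg i))\<^sup>2"
    by (intro choice allI)
  then obtain \<sigma> where bij: "\<And>i. bij (\<sigma> i)"
    and W2: "\<And>i. ennreal ((\<Sum>k\<in>UNIV. (norm (y k - pt $ i $ \<sigma> i k))\<^sup>2) / 3) \<le> (W2 \<nu> (marg i))\<^sup>2"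
    by blast
  let ?x = "\<lambda>k. xx (\<sigma> 1 k) (\<sigma> 2 k) (\<sigma> 3 k)"
  have xx_i: "?x k $ i = pt $ i $ \<sigma> i k" for k i
    using exhaust_3[of i] by auto
  have "408.38975553 \<le> (\<Sum>k\<in>UNIV. cost (\<sigma> 1 k) (\<sigma> 2 k) (\<sigma> 3 k))"
  proof -
    \<comment> \<open>Renumber the triples by their first entry to bring the plan into the form with a trivial first permutation.\<close>
    have inv: "inv (\<sigma> 1) (\<sigma> 1 k) = k" for k
      using bij by (simp add: bij_is_inj)
    have "408.38975553 = cost 1 1 3 + cost 2 2 2 + cost 3 3 1"
      by (simp add: cost_table)
    also have "\<dots> \<le> (\<Sum>j\<in>UNIV. cost j ((\<sigma> 2 \<circ> inv (\<sigma> 1)) j) ((\<sigma> 3 \<circ> inv (\<sigma> 1)) j))"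
      using bij by (intro perm_cost_ge bij_comp bij_imp_bij_inv)
    also have "\<dots> = (\<Sum>k\<in>UNIV. cost (\<sigma> 1 k) (\<sigma> 2 k) (\<sigma> 3 k))"
      using sum.reindex_bij_betw[OF bij[of 1],
          of "\<lambda>j. cost j ((\<sigma> 2 \<circ> inv (\<sigma> 1)) j) ((\<sigma> 3 \<circ> inv (\<sigma> 1)) j)"]
      by (simp add: inv)
    finally show ?thesis .
  qed
  also have "\<dots> \<le> (\<Sum>k\<in>UNIV. 6 * (\<Sum>i\<in>UNIV. (norm (y k - pt $ i $ \<sigma> i k))\<^sup>2))"
  proof (intro sum_mono)
    fix k
    show "cost (\<sigma> 1 k) (\<sigma> 2 k) (\<sigma> 3 k) \<le> 6 * (\<Sum>i\<in>UNIV. (norm (y k - pt $ i $ \<sigma> i k))\<^sup>2)"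
      using sum_norm_diff_squares[of "\<lambda>i. pt $ i $ \<sigma> i k" "y k"] by (simp add: cost_def xx_i)
  qed
  also have "\<dots> = 18 * (\<Sum>i\<in>UNIV. (\<Sum>k\<in>UNIV. (norm (y k - pt $ i $ \<sigma> i k))\<^sup>2) / 3)"
    by (subst sum_distrib_left[symmetric], subst sum.swap) (simp add: sum_divide_distrib[symmetric])
  finally have "ennreal (408.38975553 / 18)
      \<le> ennreal (\<Sum>i\<in>UNIV. (\<Sum>k\<in>UNIV. (norm (y k - pt $ i $ \<sigma> i k))\<^sup>2) / 3)"
    by (intro ennreal_leI) simp
  also have "\<dots> = (\<Sum>i\<in>UNIV. ennreal ((\<Sum>k\<in>UNIV. (norm (y k - pt $ i $ \<sigma> i k))\<^sup>2) / 3))"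
    by (subst sum_ennreal) (simp_all add: sum_nonneg)
  also have "\<dots> \<le> (\<Sum>i\<in>UNIV. (W2 \<nu> (marg i))\<^sup>2)"
    by (intro sum_mono W2)
  finally show ?thesis .
qed

lemma card_perm_plans: "card perm_plans = 36"
proof -
  let ?B = "{\<sigma> :: 3 \<Rightarrow> 3. bij \<sigma>}"
  have "?B = {\<sigma>. \<sigma> permutes UNIV}"
    by (auto simp: permutes_bij intro: bij_imp_permutes)
  then have card: "card ?B = 6"
    using card_permutations[of "UNIV :: 3 set" 3] by (simp add: fact_numeral)
  have inj: "inj_on (\<lambda>(\<sigma>, \<tau>). perm_plan \<sigma> \<tau>) (?B \<times> ?B)"
  proof (rule inj_onI)
    fix p q :: "(3 \<Rightarrow> 3) \<times> (3 \<Rightarrow> 3)"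
    assume eq: "(case p of (\<sigma>, \<tau>) \<Rightarrow> perm_plan \<sigma> \<tau>) = (case q of (\<sigma>, \<tau>) \<Rightarrow> perm_plan \<sigma> \<tau>)"
    obtain \<sigma> \<tau> \<sigma>' \<tau>' where pq: "p = (\<sigma>, \<tau>)" "q = (\<sigma>', \<tau>')"
      by (cases p, cases q)
    have "perm_plan \<sigma> \<tau> = perm_plan \<sigma>' \<tau>'"
      using eq unfolding pq by simp
    then have range: "range (\<lambda>k. xx k (\<sigma> k) (\<tau> k)) = range (\<lambda>k. xx k (\<sigma>' k) (\<tau>' k))"
      unfolding perm_plan_unif by (rule range_eq_if_unif_eq)
    have "xx k (\<sigma> k) (\<tau> k) \<in> range (\<lambda>k. xx k (\<sigma>' k) (\<tau>' k))" for k
      unfolding range[symmetric] by (rule rangeI)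
    then have "\<sigma> k = \<sigma>' k \<and> \<tau> k = \<tau>' k" for k
      by (auto simp: xx_eq_iff image_iff)
    then show "p = q" unfolding pq by auto
  qed
  have plans: "perm_plans = (\<lambda>(\<sigma>, \<tau>). perm_plan \<sigma> \<tau>) ` (?B \<times> ?B)"
    by (auto simp: perm_plans_def)
  have "card perm_plans = card (?B \<times> ?B)"
    unfolding plans by (rule card_image[OF inj])
  then show ?thesis
    by (simp add: card_cartesian_product card)
qed

section \<open>The counterexample\<close>

theorem mainTheorem1:
  shows
    "multi_minimizer marg
       (emp [xx 1 1 3, xx 1 2 2, xx 2 1 1, xx 2 2 3, xx 3 3 1, xx 3 3 2])
     \<and>
     (card perm_plans = 36
      \<and> is_arg_min multi_cost (\<lambda>\<gamma>. \<gamma> \<in> perm_plans) (emp [xx 1 1 3, xx 2 2 2, xx 3 3 1])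
      \<and> multi_cost (emp [xx 1 1 3, xx 2 2 2, xx 3 3 1]) > (INF \<gamma>\<in>multi_couplings marg. multi_cost \<gamma>)
      \<and> \<not> (\<exists>\<gamma>. monge_solution marg \<gamma>))
     \<and>
     \<not> (\<exists>\<nu>. wasserstein_barycenter marg \<nu> \<and> \<nu> \<in> empirical_measures 3)"
proof -
  let ?p = "emp [xx 1 1 3, xx 2 2 2, xx 3 3 1]"
  obtain \<rho> :: "3 \<Rightarrow> 3" where "bij \<rho>" and \<rho>: "\<rho> 1 = 3" "\<rho> 2 = 2" "\<rho> 3 = 1"
    by (rule bij_3_of_distinct[of 3 2 1]) auto
  have p: "?p = perm_plan id \<rho>"
    by (simp add: perm_plan_def \<rho>)
  have cost_p: "multi_cost ?p = ennreal (408.38975553 / 3)"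
    unfolding p multi_cost_perm_plan by (simp add: sum_3 \<rho> cost_table)
  have p_min: "multi_cost ?p \<le> multi_cost (perm_plan \<sigma> \<tau>)" if "bij \<sigma>" "bij \<tau>" for \<sigma> \<tau>
    unfolding cost_p multi_cost_perm_plan using perm_cost_ge[OF that]
    by (intro ennreal_leI) (simp add: cost_table)
  have gap: "multi_cost split_plan < multi_cost ?p"
    unfolding cost_p multi_cost_split_plan by (simp add: ennreal_less_iff)
  have split_min: "multi_cost split_plan \<le> multi_cost \<gamma>" if "\<gamma> \<in> multi_couplings marg" for \<gamma>
    unfolding multi_cost_split_plan by (rule multi_cost_marg_ge[OF that])
  have minimizer: "multi_minimizer marg split_plan"
    using split_plan_coupling split_min by (auto simp: multi_minimizer_def is_arg_min_def not_less)
  have arg_min: "is_arg_min multi_cost (\<lambda>\<gamma>. \<gamma> \<in> perm_plans) ?p"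
    unfolding is_arg_min_def perm_plans_def using p p_min bij_id \<open>bij \<rho>\<close>
    by (auto simp: not_less)
  have INF: "(INF \<gamma>\<in>multi_couplings marg. multi_cost \<gamma>) < multi_cost ?p"
    using split_plan_coupling gap by (rule INF_lower[THEN le_less_trans])
  have no_monge: "\<not> monge_solution marg \<gamma>" for \<gamma>
  proof
    assume "monge_solution marg \<gamma>"
    then have \<gamma>: "\<gamma> \<in> multi_couplings marg" and graph: "concentrated_on_graph \<gamma>"
      and "\<not> multi_cost split_plan < multi_cost \<gamma>"
      using split_plan_coupling by (auto simp: monge_solution_def multi_minimizer_def is_arg_min_def)
    moreover obtain \<sigma> \<tau> where "bij \<sigma>" "bij \<tau>" "\<gamma> = perm_plan \<sigma> \<tau>"
      by (rule graph_coupling_is_perm_plan[OF \<gamma> graph])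
    ultimately show False
      using gap p_min[of \<sigma> \<tau>] by auto
  qed
  have no_barycenter: "\<not> wasserstein_barycenter marg \<nu>" if "\<nu> \<in> empirical_measures 3" for \<nu>
  proof
    assume "wasserstein_barycenter marg \<nu>"
    obtain \<nu>' where \<nu>': "\<nu>' \<in> space (prob_algebra borel)"
      "(\<Sum>i\<in>UNIV. (W2 \<nu>' (marg i))\<^sup>2) \<le> multi_cost split_plan / of_nat (2 * CARD(3))"
      by (rule barycenter_value_le_multi_cost[OF split_plan_coupling])
    note \<nu>'(2)
    also have "multi_cost split_plan / of_nat (2 * CARD(3)) = ennreal (816.330323512 / 36)"
      unfolding multi_cost_split_plan ennreal_of_nat_eq_real_of_nat
      by (subst divide_ennreal) simp_all
    also have "\<dots> < ennreal (408.38975553 / 18)"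
      by (simp add: ennreal_less_iff)
    also have "\<dots> \<le> (\<Sum>i\<in>UNIV. (W2 \<nu> (marg i))\<^sup>2)"
      by (rule empirical_barycenter_value_ge[OF that])
    finally show False
      using \<open>wasserstein_barycenter marg \<nu>\<close> \<nu>'(1)
      by (auto simp: wasserstein_barycenter_def is_arg_min_def)
  qed
  show ?thesis
    using minimizer card_perm_plans arg_min INF no_monge no_barycenter by blast
qed

end
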